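(* Let $(\mathcal S,\leq)$ be a lower complete set of symbols and let $\sigma\colon\Sigma\to\Sigma$ be the shift homeomorphism on $\Sigma=\mathcal S^{\mathbb Z}$, $\sigma\bigl((u_k)_{k\in\mathbb Z}\bigr)=(u_{k+1})_{k\in\mathbb Z}$, where $\mathcal S$ carries the order topology and $\Sigma$ the product topology. Then $h(\sigma)=\log|\mathcal S_+|$, where $\mathcal S_+$ is the set of maximal elements of $\mathcal S$.
   Context: A lower complete set of symbols is a nonempty finite set $\mathcal S$ with a partial order $\leq$ such that every nonempty subset of $\mathcal S$ that has a lower bound in $\mathcal S$ has a greatest lower bound in $\mathcal S$. Introduce an extra symbol $0\notin\mathcal S$ with $0\leq u$ for every $u\in\mathcal S\cup\{0\}$. The order topology on $\mathcal S$ (in the sense used here) is the topology with base $\{(0,u]:u\in\mathcal S\cup\{0\}\}$, where $(0,u]=\{v\in\mathcal S:v\leq u\}$ (in particular $(0,0]=\varnothing$). The space $\Sigma$ is in general not Hausdorff. Entropy. Let $\mathscr L$ be a bounded distributive lattice with $0\neq1$, with join $\sqcup$ and meet $\sqcap$. A cover of $\mathscr L$ is a finite subset $\mathscr U\subseteq\mathscr L$ with join $\bigsqcup\mathscr U=1$; $\mathscr C(\mathscr L)$ is the set of all covers. For $\mathscr U,\mathscr V\subseteq\mathscr L$ put $\mathscr U\wedge\mathscr V=\{u\sqcap v:u\in\mathscr U,v\in\mathscr V\}$ (with $\bigwedge$ its finite iteration). A unital morphism $\lambda\colon\mathscr L\to\mathscr L$ is a map preserving $\sqcup$, $\sqcap$,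 $0$ and $1$; $\lambda\mathscr U=\{\lambda u:u\in\mathscr U\}$. For $\mathscr U\in\mathscr C(\mathscr L)$ define $h(\mathscr U)=\log\bigl(\min\{|\mathscr V|:\mathscr V\in\mathscr C(\mathscr L),\ \mathscr V\subseteq\mathscr U\}\bigr)$, $h(\lambda,\mathscr U)=\lim_{n\to\infty}\frac1n h\bigl(\bigwedge_{k=0}^{n-1}\lambda^k\mathscr U\bigr)$ (the limit exists by subadditivity), and $h(\lambda)=\sup\{h(\lambda,\mathscr U):\mathscr U\in\mathscr C(\mathscr L)\}\in[0,+\infty]$. For a continuous map $f\colon X\to X$ of a nonempty compact topological space, $h(f)$ denotes $h(\lambda_f)$, where $\mathscr L_X$ is the lattice of open sets of $X$ ordered by inclusion (join is union, meet is intersection) and $\lambda_f\colon\mathscr L_X\to\mathscr L_X$ is $\lambda_f U=f^{-1}(U)$; this is the usual (open cover) topological entropy. *)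

theory Defs
  imports "HOL-Analysis.Analysis" "HOL-Algebra.Lattice"
begin

section \<open>Entropy of lattice morphisms\<close>

locale nontrivial_bounded_distrib_lattice = bounded_lattice +
  assumes meet_join_distrib:
    "\<lbrakk>x \<in> carrier L; y \<in> carrier L; z \<in> carrier L\<rbrakk> \<Longrightarrow> x \<sqinter> (y \<squnion> z) = (x \<sqinter> y) \<squnion> (x \<sqinter> z)"
    and bottom_neq_top: "\<bottom> \<noteq> \<top>"

definition unital_morphism :: "('a, 'b) gorder_scheme \<Rightarrow> ('a \<Rightarrow> 'a) \<Rightarrow> bool" where
  "unital_morphism L \<phi> \<longleftrightarrow>
     \<phi> \<in> carrier L \<rightarrow> carrier L \<and> join_pres L L \<phi> \<and> meet_pres L L \<phi> \<and>
     \<phi> \<bottom>\<^bsub>L\<^esub> = \<bottom>\<^bsub>L\<^esub> \<and> \<phi> \<top>\<^bsub>L\<^esub> = \<top>\<^bsub>L\<^esub>"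

definition covers :: "('a, 'b) gorder_scheme \<Rightarrow> 'a set set" where
  "covers L = {U. finite U \<and> U \<subseteq> carrier L \<and> \<Squnion>\<^bsub>L\<^esub>U = \<top>\<^bsub>L\<^esub>}"

definition wedge :: "('a, 'b) gorder_scheme \<Rightarrow> 'a set \<Rightarrow> 'a set \<Rightarrow> 'a set" where
  "wedge L U V = {u \<sqinter>\<^bsub>L\<^esub> v | u v. u \<in> U \<and> v \<in> V}"

text \<open>\<open>iterated_wedge L \<phi> U n\<close> is the wedge of the \<open>\<phi>\<^sup>k U\<close> for \<open>k < n\<close>; the empty wedge is
  the neutral cover consisting of the top element only.\<close>

primrec iterated_wedge :: "('a, 'b) gorder_scheme \<Rightarrow> ('a \<Rightarrow> 'a) \<Rightarrow> 'a set \<Rightarrow> nat \<Rightarrow> 'a set" where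
  "iterated_wedge L \<phi> U 0 = {\<top>\<^bsub>L\<^esub>}"
| "iterated_wedge L \<phi> U (Suc n) = wedge L (iterated_wedge L \<phi> U n) ((\<phi> ^^ n) ` U)"

definition cover_entropy :: "('a, 'b) gorder_scheme \<Rightarrow> 'a set \<Rightarrow> real" where
  "cover_entropy L U = ln (real (Min {card V | V. V \<in> covers L \<and> V \<subseteq> U}))"

definition morphism_cover_entropy ::
    "('a, 'b) gorder_scheme \<Rightarrow> ('a \<Rightarrow> 'a) \<Rightarrow> 'a set \<Rightarrow> real" where
  "morphism_cover_entropy L \<phi> U = lim (\<lambda>n. cover_entropy L (iterated_wedge L \<phi> U n) / real n)"

definition lattice_entropy :: "('a, 'b) gorder_scheme \<Rightarrow> ('a \<Rightarrow> 'a) \<Rightarrow> ereal" where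
  "lattice_entropy L \<phi> = (SUP U \<in> covers L. ereal (morphism_cover_entropy L \<phi> U))"


section \<open>Topological entropy\<close>

definition open_lattice :: "'a topology \<Rightarrow> 'a set gorder" where
  "open_lattice X = \<lparr>carrier = {U. openin X U}, eq = (=), le = (\<subseteq>)\<rparr>"

definition open_preimage :: "'a topology \<Rightarrow> ('a \<Rightarrow> 'a) \<Rightarrow> 'a set \<Rightarrow> 'a set" where
  "open_preimage X f U = {x \<in> topspace X. f x \<in> U}"

definition topological_entropy :: "'a topology \<Rightarrow> ('a \<Rightarrow> 'a) \<Rightarrow> ereal" where
  "topological_entropy X f = lattice_entropy (open_lattice X) (open_preimage X f)"

lemma open_lattice_partial_order: "partial_order (open_lattice X)"
  by unfold_locales (auto simp: open_lattice_def)

lemma open_lattice_is_lub: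
  assumes "\<U> \<subseteq> {U. openin X U}"
  shows "is_lub (open_lattice X) (\<Union>\<U>) \<U>"
  using assms by (auto simp: least_def Upper_def open_lattice_def)

lemma open_lattice_is_glb:
  assumes "openin X U" "openin X V"
  shows "is_glb (open_lattice X) (U \<inter> V) {U, V}"
  using assms by (auto simp: greatest_def Lower_def open_lattice_def)

lemma open_lattice_sup:
  assumes "\<U> \<subseteq> {U. openin X U}"
  shows "\<Squnion>\<^bsub>open_lattice X\<^esub>\<U> = \<Union>\<U>"
proof -
  interpret partial_order "open_lattice X" by (rule open_lattice_partial_order)
  show ?thesis
    unfolding sup_def using open_lattice_is_lub[OF assms] least_unique
    by (intro some_equality) blast+
qed

lemma open_lattice_join:
  assumes "openin X U" "openin X V"
  shows "U \<squnion>\<^bsub>open_lattice X\<^esub> V = U \<union> V"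
  using open_lattice_sup[of "{U, V}" X] assms by (simp add: join_def)

lemma open_lattice_meet:
  assumes "openin X U" "openin X V"
  shows "U \<sqinter>\<^bsub>open_lattice X\<^esub> V = U \<inter> V"
proof -
  interpret partial_order "open_lattice X" by (rule open_lattice_partial_order)
  show ?thesis
    unfolding meet_def inf_def using open_lattice_is_glb[OF assms] greatest_unique
    by (intro some_equality) blast+
qed

lemma open_lattice_top: "\<top>\<^bsub>open_lattice X\<^esub> = topspace X"
proof -
  interpret partial_order "open_lattice X" by (rule open_lattice_partial_order)
  have "greatest (open_lattice X) (topspace X) (carrier (open_lattice X))"
    by (auto simp: greatest_def open_lattice_def dest: openin_subset)
  then show ?thesis
    unfolding top_def using greatest_unique by (intro some_equality) blast+
qed

lemma open_lattice_bottom: "\<bottom>\<^bsub>open_lattice X\<^esub> = {}"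
proof -
  interpret partial_order "open_lattice X" by (rule open_lattice_partial_order)
  have "least (open_lattice X) {} (carrier (open_lattice X))"
    by (auto simp: least_def open_lattice_def)
  then show ?thesis
    unfolding bottom_def using least_unique by (intro some_equality) blast+
qed

lemma open_lattice_lattice: "lattice (open_lattice X)"
proof -
  interpret partial_order "open_lattice X" by (rule open_lattice_partial_order)
  show ?thesis
  proof unfold_locales
    fix U V assume UV: "U \<in> carrier (open_lattice X)" "V \<in> carrier (open_lattice X)"
    then have *: "openin X U" "openin X V" by (auto simp: open_lattice_def)
    show "\<exists>s. is_lub (open_lattice X) s {U, V}"
      using open_lattice_is_lub[of "{U, V}" X] * by blast
    show "\<exists>s. is_glb (open_lattice X) s {U, V}"
      using open_lattice_is_glb[OF *] by blast
  qed
qed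

lemma open_lattice_nontrivial_bounded_distrib_lattice:
  assumes "topspace X \<noteq> {}"
  shows "nontrivial_bounded_distrib_lattice (open_lattice X)"
proof -
  interpret lattice "open_lattice X" by (rule open_lattice_lattice)
  show ?thesis
  proof unfold_locales
    show "\<exists>x. least (open_lattice X) x (carrier (open_lattice X))"
      by (rule exI[of _ "{}"]) (auto simp: least_def open_lattice_def)
    show "\<exists>x. greatest (open_lattice X) x (carrier (open_lattice X))"
      by (rule exI[of _ "topspace X"])
        (auto simp: greatest_def open_lattice_def dest: openin_subset)
    show "\<bottom>\<^bsub>open_lattice X\<^esub> \<noteq> \<top>\<^bsub>open_lattice X\<^esub>"
      using assms by (metis open_lattice_top open_lattice_bottom)
    fix U V W
    assume "U \<in> carrier (open_lattice X)" "V \<in> carrier (open_lattice X)"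
      "W \<in> carrier (open_lattice X)"
    then have "openin X U" "openin X V" "openin X W" by (auto simp: open_lattice_def)
    then show "U \<sqinter>\<^bsub>open_lattice X\<^esub> (V \<squnion>\<^bsub>open_lattice X\<^esub> W) =
        (U \<sqinter>\<^bsub>open_lattice X\<^esub> V) \<squnion>\<^bsub>open_lattice X\<^esub> (U \<sqinter>\<^bsub>open_lattice X\<^esub> W)"
      by (simp add: open_lattice_join open_lattice_meet openin_Un openin_Int Int_Un_distrib)
  qed
qed

lemma open_preimage_unital_morphism:
  assumes "continuous_map X X f"
  shows "unital_morphism (open_lattice X) (open_preimage X f)"
proof -
  have op: "openin X (open_preimage X f U)" if "openin X U" for U
    using assms that by (auto simp: open_preimage_def continuous_map_def)
  have "\<And>x. x \<in> topspace X \<Longrightarrow> f x \<in> topspace X"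
    using assms by (auto simp: continuous_map_def)
  then show ?thesis
    by (auto simp: unital_morphism_def join_pres_def meet_pres_def open_lattice_lattice
        open_lattice_top open_lattice_bottom op)
      (auto simp: open_lattice_def open_lattice_join[unfolded open_lattice_def]
        open_lattice_meet[unfolded open_lattice_def] op open_preimage_def[symmetric],
       auto simp: open_preimage_def)
qed


section \<open>Lower complete sets of symbols\<close>

locale lower_complete_symbols = partial_order S for S (structure) +
  assumes finite_carrier: "finite (carrier S)"
    and nonempty_carrier: "carrier S \<noteq> {}"
    and glb_exists: "\<lbrakk>A \<subseteq> carrier S; A \<noteq> {}; Lower S A \<noteq> {}\<rbrakk> \<Longrightarrow> \<exists>g. is_glb S g A"

definition maximal_elements :: "('a, 'b) gorder_scheme \<Rightarrow> 'a set" where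
  "maximal_elements S = {u \<in> carrier S. \<forall>v \<in> carrier S. u \<sqsubseteq>\<^bsub>S\<^esub> v \<longrightarrow> v = u}"

text \<open>The extra symbol \<open>0\<close> is \<^term>\<open>None\<close>; a symbol \<open>u\<close> is embedded as \<^term>\<open>Some u\<close>.\<close>

fun le_zero :: "('a, 'b) gorder_scheme \<Rightarrow> 'a option \<Rightarrow> 'a option \<Rightarrow> bool" where
  "le_zero S None _ = True"
| "le_zero S (Some u) None = False"
| "le_zero S (Some u) (Some v) = (u \<sqsubseteq>\<^bsub>S\<^esub> v)"

definition adjoin_zero :: "('a, 'b) gorder_scheme \<Rightarrow> 'a option gorder" where
  "adjoin_zero S = \<lparr>carrier = insert None (Some ` carrier S), eq = (=), le = le_zero S\<rparr>"

definition zero_interval :: "('a, 'b) gorder_scheme \<Rightarrow> 'a option \<Rightarrow> 'a set" where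
  "zero_interval S u = {v \<in> carrier S. Some v \<sqsubseteq>\<^bsub>adjoin_zero S\<^esub> u}"

definition symbol_base :: "('a, 'b) gorder_scheme \<Rightarrow> 'a set set" where
  "symbol_base S = {zero_interval S u | u. u \<in> carrier (adjoin_zero S)}"

definition symbol_topology :: "('a, 'b) gorder_scheme \<Rightarrow> 'a topology" where
  "symbol_topology S = topology (arbitrary union_of (\<lambda>B. B \<in> symbol_base S))"

text \<open>Lower completeness makes \<^const>\<open>symbol_base\<close> closed under binary intersections, so that
  it is indeed the base of a topology.\<close>

lemma (in lower_complete_symbols) symbol_base_Int:
  assumes "A \<in> symbol_base S" "B \<in> symbol_base S"
  shows "A \<inter> B \<in> symbol_base S"
proof -
  have emp: "{} \<in> symbol_base S"
    by (auto simp: symbol_base_def zero_interval_def adjoin_zero_def intro!: exI[of _ None])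
  obtain a b where a: "A = zero_interval S a" "a \<in> carrier (adjoin_zero S)"
    and b: "B = zero_interval S b" "b \<in> carrier (adjoin_zero S)"
    using assms by (auto simp: symbol_base_def)
  show ?thesis
  proof (cases "A \<inter> B = {}")
    case True
    then show ?thesis using emp by simp
  next
    case False
    then obtain u v where uv: "a = Some u" "b = Some v" "u \<in> carrier S" "v \<in> carrier S"
      using a b by (cases a; cases b) (auto simp: zero_interval_def adjoin_zero_def)
    have AB: "A \<inter> B = Lower S {u, v}"
      using uv by (auto simp: a b zero_interval_def adjoin_zero_def Lower_def)
    then obtain g where g: "is_glb S g {u, v}"
      using glb_exists[of "{u, v}"] False uv by auto
    have gS: "g \<in> carrier S" using g by (auto simp: greatest_def Lower_def)
    have "Lower S {u, v} = zero_interval S (Some g)"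
      using g gS uv by (auto simp: greatest_def Lower_def zero_interval_def adjoin_zero_def
          intro: le_trans)
    then show ?thesis using gS AB by (auto simp: symbol_base_def adjoin_zero_def)
  qed
qed

lemma (in lower_complete_symbols) openin_symbol_topology:
  "openin (symbol_topology S) = arbitrary union_of (\<lambda>B. B \<in> symbol_base S)"
  unfolding symbol_topology_def
  by (rule topology_inverse', rule istopology_base, rule symbol_base_Int)

lemma (in lower_complete_symbols) topspace_symbol_topology:
  "topspace (symbol_topology S) = carrier S"
proof
  show "topspace (symbol_topology S) \<subseteq> carrier S"
    using openin_topspace[of "symbol_topology S"]
    by (auto simp: openin_symbol_topology union_of_def symbol_base_def zero_interval_def)
next
  show "carrier S \<subseteq> topspace (symbol_topology S)"
  proof
    fix u assume u: "u \<in> carrier S"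
    then have "zero_interval S (Some u) \<in> symbol_base S"
      by (auto simp: symbol_base_def adjoin_zero_def)
    then have "openin (symbol_topology S) (zero_interval S (Some u))"
      by (auto simp: openin_symbol_topology arbitrary_def intro: union_of_inc)
    then show "u \<in> topspace (symbol_topology S)"
      using u openin_subset by (fastforce simp: zero_interval_def adjoin_zero_def)
  qed
qed

definition sequence_space :: "('a, 'b) gorder_scheme \<Rightarrow> (int \<Rightarrow> 'a) topology" where
  "sequence_space S = product_topology (\<lambda>_. symbol_topology S) UNIV"

definition shift :: "(int \<Rightarrow> 'a) \<Rightarrow> int \<Rightarrow> 'a" where
  "shift u = (\<lambda>k. u (k + 1))"

lemma shift_homeomorphic_map:
  "homeomorphic_map (sequence_space S) (sequence_space S) shift"
proof -
  have "continuous_map (sequence_space S) (sequence_space S) (\<lambda>u k. u (k + c))" for c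
    unfolding sequence_space_def
    by (auto simp: continuous_map_componentwise_UNIV intro: continuous_map_product_projection)
  from this[of 1] this[of "-1"]
  have "homeomorphic_maps (sequence_space S) (sequence_space S) shift (\<lambda>u k. u (k - 1))"
    by (auto simp: homeomorphic_maps_def shift_def[abs_def])
  then show ?thesis by (auto simp: homeomorphic_map_maps)
qed

end

theory Submission
  imports Defs
begin

text \<open>Let \<open>m\<close> be the number of maximal symbols. The cover by the sets \<open>x\<^sub>0 \<le> u\<close>, \<open>u\<close> maximal, has
  \<open>n\<close>-th iterated wedge indexed by the words of length \<open>n\<close> in maximal symbols, and no member can
  be omitted since a word of maximal symbols lies below no other one; so its entropy is at least
  \<open>ln m\<close>. Conversely, compactness gives for every cover some \<open>N\<close> such that every cylinder
  \<open>{y. \<forall>k \<in> [-N, N]. y k \<le> x k}\<close> lies in a member of the cover. The \<open>m ^ (2 N + n)\<close> cylinders over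
  \<open>[-N, N + n)\<close> given by maximal words cover the space and refine the \<open>n\<close>-th iterated wedge, so
  the entropy of the cover is at most \<open>ln m\<close>.\<close>

section \<open>Fekete's lemma\<close>

text \<open>Split off \<open>q\<close> blocks of length \<open>m\<close> one at a time. With
  \<open>q = n div m\<close> and \<open>r = n mod m\<close> this is the division step of Fekete's
  argument.\<close>

lemma subadditive_mult_add:
  fixes a :: "nat \<Rightarrow> real"
  assumes "\<And>m n. a (m + n) \<le> a m + a n"
  shows "a (q * m + r) \<le> real q * a m + a r"
proof (induction q)
  case (Suc q)
  have "a (Suc q * m + r) \<le> a m + a (q * m + r)"
    using assms[of m "q * m + r"] by (simp add: add.assoc)
  then show ?case using Suc by (simp add: algebra_simps)
qed simp

text \<open>Fekete: the limit is the infimum of the quotients, which is finite by nonnegativity. Fix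
  \<open>m\<close> with \<open>a m / m\<close> close to it; dividing \<open>n\<close> by
  \<open>m\<close> bounds \<open>a n / n\<close> by \<open>a m / m\<close> plus a term of order
  \<open>1 / n\<close>.\<close>

lemma convergent_subadditive_div:
  fixes a :: "nat \<Rightarrow> real"
  assumes sub: "\<And>m n. a (m + n) \<le> a m + a n" and nonneg: "\<And>n. 0 \<le> a n"
  shows "convergent (\<lambda>n. a n / real n)"
proof -
  \<comment> \<open>Index 0 is left out because \<open>a 0 / real 0\<close> is 0 in HOL and would
    force the infimum down to 0.\<close>
  define L where "L = (INF n\<in>{1..}. a n / real n)"
  have bdd: "bdd_below ((\<lambda>n. a n / real n) ` {1..})"
    using nonneg by (intro bdd_belowI[of _ 0]) auto
  have L_le: "L \<le> a n / real n" if "n \<ge> 1" for n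
    unfolding L_def using that by (intro cINF_lower[OF bdd]) simp
  have "(\<lambda>n. a n / real n) \<longlonglongrightarrow> L"
  proof (rule LIMSEQ_I)
    fix e :: real assume e: "e > 0"
    have "\<exists>x\<in>(\<lambda>n. a n / real n) ` {1..}. x < L + e / 2"
      unfolding L_def using e by (intro cInf_lessD) (auto simp: L_def)
    then obtain m where m: "m \<ge> 1" "a m / real m < L + e / 2" by auto
    \<comment> \<open>One constant bounding \<open>a r\<close> for every possible remainder,
      independent of \<open>n\<close>.\<close>
    define C where "C = (\<Sum>r<m. a r)"
    have C: "a r \<le> C" if "r < m" for r
      unfolding C_def using that nonneg by (intro member_le_sum) auto
    have C0: "C \<ge> 0" unfolding C_def using nonneg by (intro sum_nonneg) auto
    obtain n0 :: nat where n0: "real n0 > 2 * C / e" using reals_Archimedean2 by blast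
    show "\<exists>n0. \<forall>n\<ge>n0. norm (a n / real n - L) < e"
    proof (intro exI allI impI)
      fix n assume n: "n \<ge> max n0 1"
      have "a n \<le> real (n div m) * a m + a (n mod m)"
        using subadditive_mult_add[of a "n div m" m "n mod m"] sub by simp
      also have "\<dots> \<le> real n / real m * a m + C"
        using m nonneg C[of "n mod m"] of_nat_div_le_of_nat[of n m]
        by (intro add_mono mult_right_mono) auto
      finally have "a n / real n \<le> (real n / real m * a m + C) / real n"
        by (intro divide_right_mono) auto
      also have "\<dots> = a m / real m + C / real n"
        using n by (simp add: field_simps)
      finally have 1: "a n / real n \<le> a m / real m + C / real n" .
      have "real n > 2 * C / e" using n n0 by linarith
      then have "C / real n < e / 2" using n e by (simp add: field_simps)
      then have "a n / real n < L + e" using 1 m(2) by linarith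
      then show "norm (a n / real n - L) < e"
        using L_le[of n] n by (simp add: abs_if)
    qed
  qed
  then show ?thesis by (rule convergentI)
qed

section \<open>Entropy of open covers\<close>

text \<open>The integer inside the logarithm of \<open>cover_entropy\<close>: counting is done in
  the naturals, and logarithms enter only for the limits.\<close>

definition min_subcover_card :: "'a topology \<Rightarrow> 'a set set \<Rightarrow> nat" where
  "min_subcover_card X \<U> = Min {card \<V> | \<V>. \<V> \<in> covers (open_lattice X) \<and> \<V> \<subseteq> \<U>}"

lemma covers_open_lattice:
  "\<U> \<in> covers (open_lattice X) \<longleftrightarrow>
     finite \<U> \<and> (\<forall>U\<in>\<U>. openin X U) \<and> \<Union>\<U> = topspace X"
proof -
  have "carrier (open_lattice X) = {U. openin X U}" by (simp add: open_lattice_def)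
  then show ?thesis
    using open_lattice_sup[of \<U> X] unfolding covers_def open_lattice_top by fastforce
qed

lemma cover_entropy_eq: "cover_entropy (open_lattice X) \<U> = ln (real (min_subcover_card X \<U>))"
  by (simp add: cover_entropy_def min_subcover_card_def)

lemma finite_subcover_cards:
  assumes "finite \<U>"
  shows "finite {card \<V> | \<V>. \<V> \<in> covers L \<and> \<V> \<subseteq> \<U>}"
  by (rule finite_subset[of _ "card ` Pow \<U>"]) (use assms in auto)

lemma min_subcover_card_le:
  assumes "\<U> \<in> covers (open_lattice X)" "\<V> \<in> covers (open_lattice X)" "\<V> \<subseteq> \<U>"
  shows "min_subcover_card X \<U> \<le> card \<V>"
  unfolding min_subcover_card_def
  using assms by (intro Min_le finite_subcover_cards) (auto simp: covers_def)

text \<open>The cover is a subcover of itself, so the set of cardinalities is finite and nonempty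
  and \<open>Min\<close> is one of its elements.\<close>

lemma min_subcover_attained:
  assumes "\<U> \<in> covers (open_lattice X)"
  obtains \<V> where "\<V> \<in> covers (open_lattice X)" "\<V> \<subseteq> \<U>" "card \<V> = min_subcover_card X \<U>"
proof -
  have "min_subcover_card X \<U> \<in> {card \<V> | \<V>. \<V> \<in> covers (open_lattice X) \<and> \<V> \<subseteq> \<U>}"
    unfolding min_subcover_card_def
    using assms by (intro Min_in finite_subcover_cards) (auto simp: covers_def)
  then show thesis using that by auto
qed

lemma min_subcover_card_pos:
  assumes "\<U> \<in> covers (open_lattice X)" "topspace X \<noteq> {}"
  shows "0 < min_subcover_card X \<U>"
proof -
  obtain \<V> where "\<V> \<in> covers (open_lattice X)" "card \<V> = min_subcover_card X \<U>"
    using min_subcover_attained[OF assms(1)] by blast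
  then show ?thesis
    using assms(2) by (metis Union_empty card_gt_0_iff covers_open_lattice)
qed

text \<open>Sending each \<open>W\<close> to a member of \<open>\<U>\<close> that contains it yields
  a subcover with at most \<open>card \<W>\<close> members. Every upper bound on subcover numbers
  below goes through this.\<close>

lemma min_subcover_card_le_refinement:
  assumes \<U>: "\<U> \<in> covers (open_lattice X)"
    and \<W>: "finite \<W>" "topspace X \<subseteq> \<Union>\<W>" "\<And>W. W \<in> \<W> \<Longrightarrow> \<exists>U\<in>\<U>. W \<subseteq> U"
  shows "min_subcover_card X \<U> \<le> card \<W>"
proof -
  obtain g where g: "\<And>W. W \<in> \<W> \<Longrightarrow> g W \<in> \<U> \<and> W \<subseteq> g W" using \<W>(3) by metis
  have "\<Union>(g ` \<W>) = topspace X"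
  proof
    show "\<Union>(g ` \<W>) \<subseteq> topspace X" using g \<U> by (force simp: covers_open_lattice)
    show "topspace X \<subseteq> \<Union>(g ` \<W>)" using g \<W>(2) by fastforce
  qed
  then have "g ` \<W> \<in> covers (open_lattice X)" "g ` \<W> \<subseteq> \<U>"
    using g \<W>(1) \<U> by (auto simp: covers_open_lattice)
  then have "min_subcover_card X \<U> \<le> card (g ` \<W>)" by (rule min_subcover_card_le[OF \<U>])
  also have "\<dots> \<le> card \<W>" by (rule card_image_le[OF \<W>(1)])
  finally show ?thesis .
qed

section \<open>Iterated wedges as sets of itineraries\<close>

lemma funpow_in_topspace:
  assumes "continuous_map X X f" "x \<in> topspace X"
  shows "(f ^^ n) x \<in> topspace X"
  using assms by (induction n) (auto simp: continuous_map_def)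

text \<open>The assumption on \<open>U\<close> is what makes the case \<open>n = 0\<close> true,
  where the left side is \<open>U\<close> itself.\<close>

lemma funpow_open_preimage:
  assumes "continuous_map X X f" "U \<subseteq> topspace X"
  shows "(open_preimage X f ^^ n) U = {x \<in> topspace X. (f ^^ n) x \<in> U}"
proof (induction n)
  case (Suc n)
  then show ?case
    using funpow_in_topspace[OF assms(1), of _ 1]
    by (auto simp: open_preimage_def funpow_swap1)
qed (use assms in auto)

text \<open>A member collects the points that follow an itinerary \<open>g\<close>, visiting
  \<open>g k\<close> at time \<open>k\<close>. Both claims go through one induction: the lattice
  meet is known to be the intersection only for open sets, so the step of the first claim uses the
  second.\<close>

lemma iterated_wedge_open_lattice:
  assumes f: "continuous_map X X f" and op: "\<And>U. U \<in> \<U> \<Longrightarrow> openin X U"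
  shows "iterated_wedge (open_lattice X) (open_preimage X f) \<U> n =
     {{x \<in> topspace X. \<forall>k<n. (f ^^ k) x \<in> g k} | g. \<forall>k<n. g k \<in> \<U>}"
    and "W \<in> iterated_wedge (open_lattice X) (open_preimage X f) \<U> n \<Longrightarrow> openin X W"
proof (induction n arbitrary: W)
  case 0
  { case 1 then show ?case by (auto simp: open_lattice_top) }
  { case 2 then show ?case by (auto simp: open_lattice_top) }
next
  case (Suc n)
  let ?iw = "iterated_wedge (open_lattice X) (open_preimage X f) \<U>"
  let ?pre = "\<lambda>V. {x \<in> topspace X. (f ^^ n) x \<in> V}"
  have pre: "(open_preimage X f ^^ n) V = ?pre V" if "V \<in> \<U>" for V
    using funpow_open_preimage[OF f] op[OF that] openin_subset by metis
  have cont: "continuous_map X X (f ^^ n)"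
    by (induction n) (use f continuous_map_compose in \<open>auto simp only: funpow.simps continuous_map_id\<close>)
  have op_pre: "openin X (?pre V)" if "V \<in> \<U>" for V
    using cont op[OF that] by (auto simp: continuous_map_def)
  have "?iw (Suc n) = {u \<sqinter>\<^bsub>open_lattice X\<^esub> ?pre V | u V. u \<in> ?iw n \<and> V \<in> \<U>}"
    using pre by (auto simp: wedge_def)
  also have "\<dots> = {u \<inter> ?pre V | u V. u \<in> ?iw n \<and> V \<in> \<U>}"
    by (simp add: open_lattice_meet[OF Suc(2) op_pre] cong: rev_conj_cong)
  finally have eq: "?iw (Suc n) = {u \<inter> ?pre V | u V. u \<in> ?iw n \<and> V \<in> \<U>}" .
  { case 1
    show ?case unfolding eq Suc(1)
    proof (intro equalityI subsetI)
      fix W assume "W \<in> {u \<inter> ?pre V | u V.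
          u \<in> {{x \<in> topspace X. \<forall>k<n. (f ^^ k) x \<in> g k} | g. \<forall>k<n. g k \<in> \<U>} \<and> V \<in> \<U>}"
      then obtain g V where gV: "\<forall>k<n. g k \<in> \<U>" "V \<in> \<U>"
        "W = {x \<in> topspace X. \<forall>k<n. (f ^^ k) x \<in> g k} \<inter> ?pre V" by auto
      then show "W \<in> {{x \<in> topspace X. \<forall>k<Suc n. (f ^^ k) x \<in> g k} | g. \<forall>k<Suc n. g k \<in> \<U>}"
        by (intro CollectI exI[of _ "g(n := V)"]) (auto simp: less_Suc_eq)
    next
      fix W assume "W \<in> {{x \<in> topspace X. \<forall>k<Suc n. (f ^^ k) x \<in> g k} | g. \<forall>k<Suc n. g k \<in> \<U>}"
      then obtain g where g: "\<forall>k<Suc n. g k \<in> \<U>"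
        "W = {x \<in> topspace X. \<forall>k<Suc n. (f ^^ k) x \<in> g k}" by auto
      then have "W = {x \<in> topspace X. \<forall>k<n. (f ^^ k) x \<in> g k} \<inter> ?pre (g n)"
        by (auto simp: less_Suc_eq)
      moreover have "{x \<in> topspace X. \<forall>k<n. (f ^^ k) x \<in> g k} \<in>
          {{x \<in> topspace X. \<forall>k<n. (f ^^ k) x \<in> g k} | g. \<forall>k<n. g k \<in> \<U>}"
        using g(1) by (intro CollectI exI[of _ g]) auto
      moreover have "g n \<in> \<U>" using g(1) by simp
      ultimately show "W \<in> {u \<inter> ?pre V | u V.
          u \<in> {{x \<in> topspace X. \<forall>k<n. (f ^^ k) x \<in> g k} | g. \<forall>k<n. g k \<in> \<U>} \<and> V \<in> \<U>}"
        by (intro CollectI) (rule exI[of _ "{x \<in> topspace X. \<forall>k<n. (f ^^ k) x \<in> g k}"],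
            rule exI[of _ "g n"], intro conjI)
    qed }
  { case 2
    then obtain u V where "W = u \<inter> ?pre V" "u \<in> ?iw n" "V \<in> \<U>" unfolding eq by blast
    then show ?case using openin_Int[OF Suc(2) op_pre] by metis }
qed

lemma finite_iterated_wedge:
  assumes "finite U"
  shows "finite (iterated_wedge L \<phi> U n)"
proof (induction n)
  case (Suc n)
  have "wedge L A B = (\<lambda>(u, v). u \<sqinter>\<^bsub>L\<^esub> v) ` (A \<times> B)" for A B
    by (auto simp: wedge_def)
  then show ?case using Suc assms by simp
qed simp

text \<open>Choosing at each time a member of \<open>\<U>\<close> that contains the current point of
  the orbit gives an itinerary followed by \<open>x\<close>.\<close>

lemma iterated_wedge_covers:
  assumes f: "continuous_map X X f" and \<U>: "\<U> \<in> covers (open_lattice X)"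
  shows "iterated_wedge (open_lattice X) (open_preimage X f) \<U> n \<in> covers (open_lattice X)"
proof -
  have op: "\<And>U. U \<in> \<U> \<Longrightarrow> openin X U" and un: "\<Union>\<U> = topspace X" and fin: "finite \<U>"
    using \<U> by (auto simp: covers_open_lattice)
  let ?iw = "iterated_wedge (open_lattice X) (open_preimage X f) \<U> n"
  have "topspace X \<subseteq> \<Union>?iw"
  proof
    fix x assume x: "x \<in> topspace X"
    have "\<exists>U\<in>\<U>. (f ^^ k) x \<in> U" for k using funpow_in_topspace[OF f x] un by blast
    then obtain g where g: "\<And>k. g k \<in> \<U> \<and> (f ^^ k) x \<in> g k" by metis
    then show "x \<in> \<Union>?iw"
      using x by (auto simp: iterated_wedge_open_lattice(1)[OF f op])
  qed
  moreover have "\<Union>?iw \<subseteq> topspace X"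
    by (auto simp: iterated_wedge_open_lattice(1)[OF f op])
  ultimately show ?thesis
    using finite_iterated_wedge[OF fin] iterated_wedge_open_lattice(2)[OF f op]
    by (auto simp: covers_open_lattice)
qed

text \<open>Take minimal subcovers for lengths \<open>m\<close> and \<open>n\<close>, and pull the
  second back by \<open>f ^^ m\<close>. The pairwise intersections cover the space and refine the
  wedge of length \<open>m + n\<close>.\<close>

lemma min_subcover_card_iterated_wedge_add:
  fixes X f \<U>
  defines "N \<equiv> \<lambda>n. min_subcover_card X (iterated_wedge (open_lattice X) (open_preimage X f) \<U> n)"
  assumes f: "continuous_map X X f" and \<U>: "\<U> \<in> covers (open_lattice X)"
  shows "N (m + n) \<le> N m * N n"
proof -
  let ?iw = "iterated_wedge (open_lattice X) (open_preimage X f) \<U>"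
  have op: "\<And>U. U \<in> \<U> \<Longrightarrow> openin X U" using \<U> by (auto simp: covers_open_lattice)
  note iw = iterated_wedge_open_lattice(1)[OF f op]
  note cov = iterated_wedge_covers[OF f \<U>]
  obtain \<A> where \<A>: "\<A> \<in> covers (open_lattice X)" "\<A> \<subseteq> ?iw m" "card \<A> = N m"
    using min_subcover_attained[OF cov] unfolding N_def by blast
  obtain \<B> where \<B>: "\<B> \<in> covers (open_lattice X)" "\<B> \<subseteq> ?iw n" "card \<B> = N n"
    using min_subcover_attained[OF cov] unfolding N_def by blast
  define join where "join = (\<lambda>(A, B). {x \<in> A. (f ^^ m) x \<in> B})"
  have fin: "finite (\<A> \<times> \<B>)" using \<A>(1) \<B>(1) by (auto simp: covers_open_lattice)
  have "N (m + n) \<le> card (join ` (\<A> \<times> \<B>))"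
    unfolding N_def
  proof (rule min_subcover_card_le_refinement[OF cov])
    show "finite (join ` (\<A> \<times> \<B>))" using fin by simp
    show "topspace X \<subseteq> \<Union>(join ` (\<A> \<times> \<B>))"
    proof
      fix x assume x: "x \<in> topspace X"
      obtain A where "A \<in> \<A>" "x \<in> A" using \<A>(1) x by (auto simp: covers_open_lattice)
      moreover obtain B where "B \<in> \<B>" "(f ^^ m) x \<in> B"
        using \<B>(1) funpow_in_topspace[OF f x, of m] unfolding covers_open_lattice by blast
      ultimately show "x \<in> \<Union>(join ` (\<A> \<times> \<B>))" by (force simp: join_def)
    qed
    fix W assume "W \<in> join ` (\<A> \<times> \<B>)"
    then obtain A B where AB: "A \<in> ?iw m" "B \<in> ?iw n" "W = {x \<in> A. (f ^^ m) x \<in> B}"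
      using \<A>(2) \<B>(2) by (auto simp: join_def)
    obtain g where g: "\<forall>k<m. g k \<in> \<U>" "A = {x \<in> topspace X. \<forall>k<m. (f ^^ k) x \<in> g k}"
      using AB(1) iw by auto
    obtain h where h: "\<forall>k<n. h k \<in> \<U>" "B = {x \<in> topspace X. \<forall>k<n. (f ^^ k) x \<in> h k}"
      using AB(2) iw by auto
    \<comment> \<open>Concatenated itinerary: \<open>g\<close> up to time \<open>m\<close>, then
      \<open>h\<close> with its clock restarted.\<close>
    define gh where "gh = (\<lambda>k. if k < m then g k else h (k - m))"
    have "\<forall>k<m + n. gh k \<in> \<U>" using g(1) h(1) by (auto simp: gh_def)
    then have "{x \<in> topspace X. \<forall>k<m + n. (f ^^ k) x \<in> gh k} \<in> ?iw (m + n)"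
      using iw by blast
    moreover have "(f ^^ k) x \<in> gh k" if "x \<in> W" "k < m + n" for x k
    proof (cases "k < m")
      case False
      have "(f ^^ (k - m)) ((f ^^ m) x) \<in> h (k - m)"
        using that False AB(3) h(2) by auto
      then show ?thesis using False funpow_add[of "k - m" m f] by (simp add: gh_def)
    qed (use that AB(3) g(2) in \<open>auto simp: gh_def\<close>)
    moreover have "W \<subseteq> topspace X" using AB(3) g(2) by auto
    ultimately show "\<exists>U\<in>?iw (m + n). W \<subseteq> U"
      by (intro bexI[of _ "{x \<in> topspace X. \<forall>k<m + n. (f ^^ k) x \<in> gh k}"]) auto
  qed
  also have "\<dots> \<le> card \<A> * card \<B>" using card_image_le[OF fin] by (simp add: card_cartesian_product)
  finally show ?thesis using \<A>(3) \<B>(3) by simp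
qed

text \<open>\<open>lim\<close> carries information only once convergence is known. Logarithms turn
  submultiplicativity into subadditivity, so Fekete's lemma applies, and the entropy can then be
  bounded term by term.\<close>

lemma morphism_cover_entropy_limit:
  assumes f: "continuous_map X X f" and \<U>: "\<U> \<in> covers (open_lattice X)" and ne: "topspace X \<noteq> {}"
  shows "(\<lambda>n. ln (real (min_subcover_card X
             (iterated_wedge (open_lattice X) (open_preimage X f) \<U> n))) / real n)
     \<longlonglongrightarrow> morphism_cover_entropy (open_lattice X) (open_preimage X f) \<U>"
proof -
  define N where
    "N = (\<lambda>n. min_subcover_card X (iterated_wedge (open_lattice X) (open_preimage X f) \<U> n))"
  have pos: "N n > 0" for n
    unfolding N_def by (rule min_subcover_card_pos[OF iterated_wedge_covers[OF f \<U>] ne])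
  have "convergent (\<lambda>n. ln (real (N n)) / real n)"
  proof (rule convergent_subadditive_div)
    fix m n
    have "real (N (m + n)) \<le> real (N m) * real (N n)"
      using min_subcover_card_iterated_wedge_add[OF f \<U>, of m n]
      unfolding N_def of_nat_mult[symmetric] of_nat_le_iff .
    then have "ln (real (N (m + n))) \<le> ln (real (N m) * real (N n))"
      using pos[of "m + n"] by simp
    then show "ln (real (N (m + n))) \<le> ln (real (N m)) + ln (real (N n))"
      using pos[of m] pos[of n] by (simp add: ln_mult)
    show "0 \<le> ln (real (N n))" using pos[of n] by simp
  qed
  then show ?thesis
    unfolding N_def morphism_cover_entropy_def cover_entropy_eq convergent_LIMSEQ_iff .
qed

section \<open>The shift on a lower complete set of symbols\<close>

text \<open>For finite \<open>F\<close> and \<open>x\<close> in the space, the smallest product of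
  open sets that contains \<open>x\<close> and restricts only coordinates in \<open>F\<close>. Only
  the values of \<open>x\<close> on \<open>F\<close> enter, so words over \<open>F\<close> can stand
  in for points.\<close>

definition cylinder :: "('a, 'b) gorder_scheme \<Rightarrow> int set \<Rightarrow> (int \<Rightarrow> 'a) \<Rightarrow> (int \<Rightarrow> 'a) set" where
  "cylinder S F x = {y. (\<forall>k. y k \<in> carrier S) \<and> (\<forall>k\<in>F. y k \<sqsubseteq>\<^bsub>S\<^esub> x k)}"

lemma funpow_shift: "(shift ^^ n) x = (\<lambda>k. x (k + int n))"
  by (induction n) (auto simp: shift_def algebra_simps)

lemma continuous_map_shift: "continuous_map (sequence_space S) (sequence_space S) shift"
  using shift_homeomorphic_map homeomorphic_imp_continuous_map by blast

context lower_complete_symbols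
begin

section \<open>Open sets, compactness and cylinders\<close>

lemma openin_zero_interval:
  "u \<in> carrier S \<Longrightarrow> openin (symbol_topology S) (zero_interval S (Some u))"
  by (auto simp: openin_symbol_topology symbol_base_def adjoin_zero_def arbitrary_def
      intro!: union_of_inc)

lemma zero_interval_Some: "zero_interval S (Some u) = {v \<in> carrier S. v \<sqsubseteq> u}"
  by (simp add: zero_interval_def adjoin_zero_def)

text \<open>Nonempty base sets are intervals below a symbol, hence closed downwards, and so are
  their unions.\<close>

lemma openin_symbol_topology_downward:
  assumes "openin (symbol_topology S) U" "u \<in> U" "v \<in> carrier S" "v \<sqsubseteq> u"
  shows "v \<in> U"
proof -
  obtain B where B: "B \<in> symbol_base S" "u \<in> B" "B \<subseteq> U"
    using assms(1,2) by (auto simp: openin_symbol_topology union_of_def arbitrary_def)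
  then obtain a where "a \<in> carrier S" "B = zero_interval S (Some a)"
    by (auto simp: symbol_base_def adjoin_zero_def zero_interval_def)
  then show ?thesis
    using B assms(3,4) le_trans[of v u a] by (auto simp: zero_interval_Some)
qed

lemma topspace_sequence_space: "topspace (sequence_space S) = {x. \<forall>k. x k \<in> carrier S}"
  by (auto simp: sequence_space_def topspace_symbol_topology)

lemma topspace_sequence_space_nonempty: "topspace (sequence_space S) \<noteq> {}"
proof -
  obtain a where "a \<in> carrier S" using nonempty_carrier by blast
  then have "(\<lambda>_. a) \<in> topspace (sequence_space S)" by (simp add: topspace_sequence_space)
  then show ?thesis by blast
qed

text \<open>Tychonoff, each factor being finite.\<close>

lemma compact_space_sequence_space: "compact_space (sequence_space S)"
  unfolding sequence_space_def compact_space_product_topology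
  using finite_imp_compactin[of "topspace (symbol_topology S)" "symbol_topology S"]
  by (simp add: compact_space_def topspace_symbol_topology finite_carrier)

lemma openin_cylinder:
  assumes "finite F" "\<And>k. x k \<in> carrier S"
  shows "openin (sequence_space S) (cylinder S F x)"
proof -
  have eq: "cylinder S F x =
      (\<Pi>\<^sub>E k\<in>UNIV. if k \<in> F then zero_interval S (Some (x k)) else carrier S)"
    by (auto simp: cylinder_def zero_interval_Some PiE_iff split: if_splits)
  show ?thesis unfolding sequence_space_def eq
  proof (rule product_topology_basis)
    show "openin (symbol_topology S) (if k \<in> F then zero_interval S (Some (x k)) else carrier S)" for k
      using openin_zero_interval assms(2) openin_topspace[of "symbol_topology S"]
      by (simp add: topspace_symbol_topology)
    show "finite {k. (if k \<in> F then zero_interval S (Some (x k)) else carrier S)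
        \<noteq> topspace (symbol_topology S)}"
      by (rule finite_subset[OF _ assms(1)]) (auto simp: topspace_symbol_topology)
  qed
qed

text \<open>A basic product neighbourhood of \<open>x\<close> restricts finitely many coordinates.
  At each of these its factor is closed downwards, so it contains every symbol below
  \<open>x k\<close>.\<close>

lemma cylinder_subset_open:
  assumes "openin (sequence_space S) U" "x \<in> U"
  obtains F where "finite F" "cylinder S F x \<subseteq> U"
proof -
  obtain V where V: "finite {k. V k \<noteq> topspace (symbol_topology S)}"
    "\<And>k. openin (symbol_topology S) (V k)" "x \<in> Pi\<^sub>E UNIV V" "Pi\<^sub>E UNIV V \<subseteq> U"
    using assms by (fastforce simp: sequence_space_def openin_product_topology_alt)
  let ?F = "{k. V k \<noteq> topspace (symbol_topology S)}"
  have "y k \<in> V k" if "y \<in> cylinder S ?F x" for y k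
  proof (cases "k \<in> ?F")
    case True
    then show ?thesis
      using that V(2)[of k] V(3) openin_symbol_topology_downward[of "V k" "x k" "y k"]
      by (auto simp: cylinder_def PiE_iff)
  qed (use that in \<open>auto simp: cylinder_def topspace_symbol_topology\<close>)
  then have "cylinder S ?F x \<subseteq> U" using V(4) by (auto simp: PiE_iff)
  then show thesis using that V(1) by blast
qed

lemma mem_cylinder_self: "(\<And>k. x k \<in> carrier S) \<Longrightarrow> x \<in> cylinder S F x"
  by (simp add: cylinder_def)

text \<open>Transitivity of the order; it replaces the triangle inequality in the Lebesgue number
  argument.\<close>

lemma cylinder_subset:
  assumes "x \<in> cylinder S F y" "F \<subseteq> G" "\<And>k. y k \<in> carrier S"
  shows "cylinder S G x \<subseteq> cylinder S F y"
proof
  fix z assume z: "z \<in> cylinder S G x"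
  have "z k \<sqsubseteq> y k" if "k \<in> F" for k
    using z assms that le_trans[of "z k" "x k" "y k"] by (auto simp: cylinder_def)
  then show "z \<in> cylinder S F y" using z by (simp add: cylinder_def)
qed

text \<open>The analogue of the Lebesgue number lemma for cylinders.\<close>

lemma uniform_cylinder_refinement:
  assumes "\<U> \<in> covers (open_lattice (sequence_space S))"
  obtains N :: nat where
    "\<And>x. (\<And>k. x k \<in> carrier S) \<Longrightarrow> \<exists>U\<in>\<U>. cylinder S {- int N..int N} x \<subseteq> U"
proof -
  let ?X = "sequence_space S"
  have op: "\<And>U. U \<in> \<U> \<Longrightarrow> openin ?X U" and un: "\<Union>\<U> = topspace ?X"
    using assms by (auto simp: covers_open_lattice)
  have "\<exists>F. finite F \<and> (\<exists>U\<in>\<U>. cylinder S F x \<subseteq> U)" if "x \<in> topspace ?X" for x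
    using that un op cylinder_subset_open[of _ x] by (metis UnionE)
  then obtain F where F: "\<And>x. x \<in> topspace ?X \<Longrightarrow> finite (F x) \<and> (\<exists>U\<in>\<U>. cylinder S (F x) x \<subseteq> U)"
    by metis
  let ?C = "(\<lambda>x. cylinder S (F x) x) ` topspace ?X"
  have "topspace ?X \<subseteq> \<Union>?C"
    using mem_cylinder_self by (fastforce simp: topspace_sequence_space)
  moreover have "\<And>C. C \<in> ?C \<Longrightarrow> openin ?X C"
    using F openin_cylinder by (auto simp: topspace_sequence_space)
  ultimately have "\<exists>\<D>. finite \<D> \<and> \<D> \<subseteq> ?C \<and> topspace ?X \<subseteq> \<Union>\<D>"
    using compact_space_sequence_space[unfolded compact_space_alt, rule_format, of ?C] by blast
  then obtain \<D> where \<D>: "finite \<D>" "\<D> \<subseteq> ?C" "topspace ?X \<subseteq> \<Union>\<D>" by blast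
  obtain P where "P \<subseteq> topspace ?X" "finite P" "\<D> = (\<lambda>x. cylinder S (F x) x) ` P"
    using finite_subset_image[OF \<D>(1,2)] by blast
  then have P: "finite P" "P \<subseteq> topspace ?X" "topspace ?X \<subseteq> (\<Union>x\<in>P. cylinder S (F x) x)"
    using \<D>(3) by auto
  have "finite (\<Union>x\<in>P. F x)" using P F by blast
  then have "finite ((\<lambda>k. nat \<bar>k\<bar>) ` (\<Union>x\<in>P. F x))" by simp
  \<comment> \<open>\<open>N\<close> bounds the absolute values of all coordinates restricted by the
    finite subcover.\<close>
  then obtain N where N: "\<forall>i\<in>(\<lambda>k. nat \<bar>k\<bar>) ` (\<Union>x\<in>P. F x). i \<le> N"
    using finite_nat_set_iff_bounded_le by blast
  show thesis
  proof (rule that[of N])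
    fix x :: "int \<Rightarrow> 'a" assume x: "\<And>k. x k \<in> carrier S"
    then obtain p where p: "p \<in> P" "x \<in> cylinder S (F p) p"
      using P(3) by (auto simp: topspace_sequence_space)
    have "F p \<subseteq> {- int N..int N}"
    proof
      fix k assume "k \<in> F p"
      then have "nat \<bar>k\<bar> \<le> N" using N p(1) by blast
      then show "k \<in> {- int N..int N}" by auto
    qed
    moreover have "\<And>k. p k \<in> carrier S" using p(1) P(2) by (auto simp: topspace_sequence_space)
    ultimately have "cylinder S {- int N..int N} x \<subseteq> cylinder S (F p) p"
      using cylinder_subset[OF p(2)] by blast
    moreover obtain U where "U \<in> \<U>" "cylinder S (F p) p \<subseteq> U" using F p(1) P(2) by blast
    ultimately show "\<exists>U\<in>\<U>. cylinder S {- int N..int N} x \<subseteq> U" by blast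
  qed
qed

section \<open>Maximal symbols\<close>

text \<open>Induction on the number of symbols above \<open>u\<close>: passing to a strictly larger
  symbol loses at least \<open>u\<close> itself, by antisymmetry.\<close>

lemma le_maximal_element:
  assumes "u \<in> carrier S"
  shows "\<exists>v\<in>maximal_elements S. u \<sqsubseteq> v"
  using assms
proof (induction "card {w \<in> carrier S. u \<sqsubseteq> w}" arbitrary: u rule: less_induct)
  case less
  show ?case
  proof (cases "u \<in> maximal_elements S")
    case False
    then obtain v where v: "v \<in> carrier S" "u \<sqsubseteq> v" "v \<noteq> u"
      using less.prems by (auto simp: maximal_elements_def)
    have "{w \<in> carrier S. v \<sqsubseteq> w} \<subset> {w \<in> carrier S. u \<sqsubseteq> w}"
      using v less.prems le_trans[of u v] le_antisym[of u v] by blast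
    then have "card {w \<in> carrier S. v \<sqsubseteq> w} < card {w \<in> carrier S. u \<sqsubseteq> w}"
      using finite_carrier by (intro psubset_card_mono) auto
    then obtain w where "w \<in> maximal_elements S" "v \<sqsubseteq> w" using less.hyps v(1) by blast
    then show ?thesis
      using v less.prems le_trans[of u v w] by (auto simp: maximal_elements_def)
  qed (use less.prems in auto)
qed

lemma maximal_elements_subset: "maximal_elements S \<subseteq> carrier S"
  by (auto simp: maximal_elements_def)

lemma finite_maximal_elements: "finite (maximal_elements S)"
  using finite_subset[OF maximal_elements_subset finite_carrier] .

lemma maximal_elements_nonempty: "maximal_elements S \<noteq> {}"
  using nonempty_carrier le_maximal_element by blast

lemma card_maximal_elements_pos: "0 < card (maximal_elements S)"
  using finite_maximal_elements maximal_elements_nonempty card_gt_0_iff by blast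

section \<open>The upper bound\<close>

text \<open>Cylinders of maximal words cover the space because every symbol lies below a maximal
  one. A long enough word determines, at each time \<open>k < n\<close>, a member of the cover
  containing the shifted cylinder. The constant \<open>N\<close> must not depend on
  \<open>n\<close>, so that it vanishes in the limit.\<close>

lemma min_subcover_card_iterated_wedge_le:
  assumes \<U>: "\<U> \<in> covers (open_lattice (sequence_space S))"
  obtains N where "\<And>n. min_subcover_card (sequence_space S)
      (iterated_wedge (open_lattice (sequence_space S)) (open_preimage (sequence_space S) shift) \<U> n)
    \<le> card (maximal_elements S) ^ (N + n)"
proof -
  let ?X = "sequence_space S" and ?M = "maximal_elements S"
  let ?iw = "iterated_wedge (open_lattice ?X) (open_preimage ?X shift) \<U>"
  have op: "\<And>U. U \<in> \<U> \<Longrightarrow> openin ?X U" using \<U> by (auto simp: covers_open_lattice)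
  obtain N :: nat where
    N: "\<And>x. (\<And>k. x k \<in> carrier S) \<Longrightarrow> \<exists>U\<in>\<U>. cylinder S {- int N..int N} x \<subseteq> U"
    using uniform_cylinder_refinement[OF \<U>] by metis
  obtain a where a: "a \<in> ?M" using maximal_elements_nonempty by blast
  have "min_subcover_card ?X (?iw n) \<le> card ?M ^ ((2 * N + 1) + n)" for n
  proof -
    \<comment> \<open>\<open>I\<close> contains \<open>i + k\<close> whenever \<open>i\<close> is in
      the window from \<open>-N\<close> to \<open>N\<close> and \<open>k < n\<close>. Its size
      exceeds \<open>n\<close> by the constant \<open>2 * N + 1\<close>.\<close>
    define I where "I = {- int N..<int N + 1 + int n}"
    define P where "P = (\<Pi>\<^sub>E k\<in>I. ?M)"
    have I: "finite I" "card I = 2 * N + 1 + n" by (auto simp: I_def)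
    have P: "finite P" "card P = card ?M ^ (2 * N + 1 + n)"
      using I finite_maximal_elements by (auto simp: P_def card_PiE finite_PiE)
    have "min_subcover_card ?X (?iw n) \<le> card (cylinder S I ` P)"
    proof (rule min_subcover_card_le_refinement[OF iterated_wedge_covers[OF continuous_map_shift \<U>]])
      show "finite (cylinder S I ` P)" using P(1) by simp
      show "topspace ?X \<subseteq> \<Union>(cylinder S I ` P)"
      proof
        fix x assume "x \<in> topspace ?X"
        then have x: "x k \<in> carrier S" for k by (simp add: topspace_sequence_space)
        obtain w where w: "\<And>k. w k \<in> ?M \<and> x k \<sqsubseteq> w k" using le_maximal_element[OF x] by metis
        then have "restrict w I \<in> P" "x \<in> cylinder S I (restrict w I)"
          using x w by (auto simp: P_def cylinder_def)
        then show "x \<in> \<Union>(cylinder S I ` P)" by blast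
      qed
      fix C assume "C \<in> cylinder S I ` P"
      then obtain w where w: "w \<in> P" "C = cylinder S I w" by blast
      \<comment> \<open>\<open>w\<close> is \<open>undefined\<close> off \<open>I\<close>; filling
        in \<open>a\<close> gives a point of the space, to whose translates the uniform refinement
        applies.\<close>
      define x where "x = (\<lambda>k. if k \<in> I then w k else a)"
      have x: "x k \<in> carrier S" for k
        using w(1) a maximal_elements_subset by (auto simp: x_def P_def)
      have "\<exists>U\<in>\<U>. cylinder S {- int N..int N} (\<lambda>i. x (i + int k)) \<subseteq> U" for k
        using N[of "\<lambda>i. x (i + int k)"] x by simp
      then obtain g where
        g: "\<And>k. g k \<in> \<U> \<and> cylinder S {- int N..int N} (\<lambda>i. x (i + int k)) \<subseteq> g k" by metis
      have "(shift ^^ k) y \<in> g k" if "y \<in> C" "k < n" for y k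
      proof -
        have "i + int k \<in> I" if "i \<in> {- int N..int N}" for i
          using that \<open>k < n\<close> by (auto simp: I_def)
        then have "(shift ^^ k) y \<in> cylinder S {- int N..int N} (\<lambda>i. x (i + int k))"
          using that(1) w(2) by (auto simp: cylinder_def funpow_shift x_def)
        then show ?thesis using g by blast
      qed
      moreover have "C \<subseteq> topspace ?X" using w(2) by (auto simp: cylinder_def topspace_sequence_space)
      ultimately have "C \<subseteq> {y \<in> topspace ?X. \<forall>k<n. (shift ^^ k) y \<in> g k}" by blast
      moreover have "{y \<in> topspace ?X. \<forall>k<n. (shift ^^ k) y \<in> g k} \<in> ?iw n"
        using g by (auto simp: iterated_wedge_open_lattice(1)[OF continuous_map_shift op])
      ultimately show "\<exists>U\<in>?iw n. C \<subseteq> U" by blast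
    qed
    also have "\<dots> \<le> card ?M ^ (2 * N + 1 + n)" using card_image_le[OF P(1)] P(2) by metis
    finally show ?thesis .
  qed
  then show thesis by (rule that)
qed

lemma morphism_cover_entropy_shift_le:
  assumes \<U>: "\<U> \<in> covers (open_lattice (sequence_space S))"
  shows "morphism_cover_entropy (open_lattice (sequence_space S))
     (open_preimage (sequence_space S) shift) \<U> \<le> ln (real (card (maximal_elements S)))"
proof -
  let ?X = "sequence_space S" and ?m = "real (card (maximal_elements S))"
  let ?iw = "iterated_wedge (open_lattice ?X) (open_preimage ?X shift) \<U>"
  obtain N where N: "\<And>n. min_subcover_card ?X (?iw n) \<le> card (maximal_elements S) ^ (N + n)"
    using min_subcover_card_iterated_wedge_le[OF \<U>] by blast
  \<comment> \<open>The bound \<open>(N + n) * ln ?m\<close>, divided by \<open>n\<close>; the share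
    of the fixed \<open>N\<close> tends to 0.\<close>
  have lim: "(\<lambda>n. ln ?m * real N / real n + ln ?m) \<longlonglongrightarrow> 0 + ln ?m"
    by (intro tendsto_add tendsto_const lim_const_over_n)
  have "ln (real (min_subcover_card ?X (?iw n))) / real n \<le> ln ?m * real N / real n + ln ?m"
    if "n \<ge> 1" for n
  proof -
    have "0 < min_subcover_card ?X (?iw n)"
      by (rule min_subcover_card_pos[OF iterated_wedge_covers[OF continuous_map_shift \<U>]
          topspace_sequence_space_nonempty])
    moreover have "real (min_subcover_card ?X (?iw n)) \<le> ?m ^ (N + n)"
      using N[of n] unfolding of_nat_power[symmetric] of_nat_le_iff .
    ultimately have "ln (real (min_subcover_card ?X (?iw n))) \<le> ln (?m ^ (N + n))"
      using card_maximal_elements_pos by (subst ln_le_cancel_iff) auto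
    also have "\<dots> = real (N + n) * ln ?m"
      using card_maximal_elements_pos by (simp add: ln_realpow)
    finally show ?thesis using that by (simp add: field_simps)
  qed
  then have "\<exists>n0. \<forall>n\<ge>n0. ln (real (min_subcover_card ?X (?iw n))) / real n
      \<le> ln ?m * real N / real n + ln ?m" by blast
  then have "morphism_cover_entropy (open_lattice ?X) (open_preimage ?X shift) \<U> \<le> 0 + ln ?m"
    by (rule LIMSEQ_le[OF morphism_cover_entropy_limit[OF continuous_map_shift \<U>
            topspace_sequence_space_nonempty] lim])
  then show ?thesis by simp
qed

section \<open>The lower bound\<close>

text \<open>The cover that will attain the supremum. It covers because \<open>x 0\<close> lies below
  some maximal symbol.\<close>

lemma maximal_cylinders_cover:
  "(\<lambda>u. cylinder S {0} (\<lambda>_. u)) ` maximal_elements S \<in> covers (open_lattice (sequence_space S))"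
proof -
  have "x \<in> (\<Union>u\<in>maximal_elements S. cylinder S {0} (\<lambda>_. u))" if "\<forall>k. x k \<in> carrier S" for x
    using that le_maximal_element[of "x 0"] by (auto simp: cylinder_def)
  then show ?thesis
    using finite_maximal_elements openin_cylinder[of "{0}" "\<lambda>_. u" for u] maximal_elements_subset
    by (auto simp: covers_open_lattice topspace_sequence_space cylinder_def)
qed

lemma le_maximal_eq: "u \<in> maximal_elements S \<Longrightarrow> v \<in> carrier S \<Longrightarrow> u \<sqsubseteq> v \<Longrightarrow> v = u"
  by (simp add: maximal_elements_def)

text \<open>Every maximal word of length \<open>n\<close> gives a test point, and no member of the
  wedge contains two of them: at each time both letters would lie below one symbol \<open>u\<close>,
  hence equal it by maximality. So a subcover has at least as many members as there are
  words.\<close>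

lemma min_subcover_card_maximal_cylinders_ge:
  defines "\<U> \<equiv> (\<lambda>u. cylinder S {0} (\<lambda>_. u)) ` maximal_elements S"
  shows "card (maximal_elements S) ^ n \<le> min_subcover_card (sequence_space S)
      (iterated_wedge (open_lattice (sequence_space S)) (open_preimage (sequence_space S) shift) \<U> n)"
proof -
  let ?X = "sequence_space S" and ?M = "maximal_elements S"
  let ?iw = "iterated_wedge (open_lattice ?X) (open_preimage ?X shift) \<U>"
  have \<U>: "\<U> \<in> covers (open_lattice ?X)" unfolding \<U>_def by (rule maximal_cylinders_cover)
  then have op: "\<And>U. U \<in> \<U> \<Longrightarrow> openin ?X U" by (auto simp: covers_open_lattice)
  obtain \<V> where \<V>: "\<V> \<in> covers (open_lattice ?X)" "\<V> \<subseteq> ?iw n"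
    "card \<V> = min_subcover_card ?X (?iw n)"
    using min_subcover_attained[OF iterated_wedge_covers[OF continuous_map_shift \<U>]] by blast
  obtain a where a: "a \<in> ?M" using maximal_elements_nonempty by blast
  define P where "P = (\<Pi>\<^sub>E k\<in>{..<n}. ?M)"
  \<comment> \<open>The word sits on coordinates 0 to \<open>n - 1\<close>; the constant
    \<open>a\<close> fills the rest.\<close>
  define pt where "pt = (\<lambda>(w :: nat \<Rightarrow> 'a) k :: int. if 0 \<le> k \<and> k < int n then w (nat k) else a)"
  have pt: "pt w k \<in> carrier S" if "w \<in> P" for w k
    using that a maximal_elements_subset by (auto simp: pt_def P_def PiE_iff nat_less_iff)
  have "\<exists>A\<in>\<V>. pt w \<in> A" if "w \<in> P" for w
    using pt[OF that] \<V>(1) by (auto simp: covers_open_lattice topspace_sequence_space)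
  then obtain A where A: "\<And>w. w \<in> P \<Longrightarrow> A w \<in> \<V> \<and> pt w \<in> A w" by metis
  have eqI: "v = w" if v: "v \<in> P" and w: "w \<in> P" and eq: "A v = A w" for v w
  proof -
    have "A v \<in> ?iw n" using A[OF v] \<V>(2) by blast
    then obtain g where g: "\<forall>k<n. g k \<in> \<U>" "A v = {y \<in> topspace ?X. \<forall>k<n. (shift ^^ k) y \<in> g k}"
      by (auto simp: iterated_wedge_open_lattice(1)[OF continuous_map_shift op])
    have "v k = w k" if k: "k < n" for k
    proof -
      obtain u where u: "u \<in> ?M" "g k = cylinder S {0} (\<lambda>_. u)" using g(1) k by (auto simp: \<U>_def)
      have "pt v \<in> A v" "pt w \<in> A v" using A[OF v] A[OF w] eq by auto
      then have "(shift ^^ k) (pt v) \<in> g k" "(shift ^^ k) (pt w) \<in> g k" using g(2) k by auto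
      \<comment> \<open>\<open>shift ^^ k\<close> moves letter \<open>k\<close> to coordinate 0, the
        only one a member of \<open>\<U>\<close> restricts.\<close>
      then have "v k \<sqsubseteq> u" "w k \<sqsubseteq> u"
        using k by (auto simp: u(2) cylinder_def funpow_shift pt_def)
      moreover have "v k \<in> ?M" "w k \<in> ?M" using v w k by (auto simp: P_def)
      ultimately show ?thesis
        using le_maximal_eq u(1) maximal_elements_subset by (metis subsetD)
    qed
    then show ?thesis using v w unfolding P_def by (intro PiE_ext[of v _ _ w]) auto
  qed
  have "card ?M ^ n = card P" by (simp add: P_def card_PiE)
  \<comment> \<open>By \<open>eqI\<close>, the choice \<open>A\<close> of a member around each test
    point is injective on words.\<close>
  also have "\<dots> \<le> card \<V>"
    using A \<V>(1) eqI by (intro card_inj_on_le[of A]) (auto simp: inj_on_def covers_open_lattice)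
  finally show ?thesis using \<V>(3) by simp
qed

lemma morphism_cover_entropy_maximal_cylinders_ge:
  "ln (real (card (maximal_elements S))) \<le> morphism_cover_entropy (open_lattice (sequence_space S))
     (open_preimage (sequence_space S) shift)
     ((\<lambda>u. cylinder S {0} (\<lambda>_. u)) ` maximal_elements S)"
proof (rule LIMSEQ_le_const[OF morphism_cover_entropy_limit[OF continuous_map_shift
        maximal_cylinders_cover topspace_sequence_space_nonempty]], intro exI allI impI)
  \<comment> \<open>The bound starts at 1, since the quotient is 0 at \<open>n = 0\<close>.\<close>
  fix n :: nat assume n: "1 \<le> n"
  let ?X = "sequence_space S" and ?m = "real (card (maximal_elements S))"
  let ?N = "min_subcover_card ?X (iterated_wedge (open_lattice ?X) (open_preimage ?X shift)
    ((\<lambda>u. cylinder S {0} (\<lambda>_. u)) ` maximal_elements S) n)"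
  have "?m ^ n \<le> real ?N"
    using min_subcover_card_maximal_cylinders_ge[of n]
    unfolding of_nat_power[symmetric] of_nat_le_iff .
  moreover have "0 < ?m ^ n" using card_maximal_elements_pos by simp
  ultimately have "ln (?m ^ n) \<le> ln (real ?N)" by (rule ln_mono)
  moreover have "ln (?m ^ n) = real n * ln ?m"
    using card_maximal_elements_pos by (simp add: ln_realpow)
  ultimately show "ln ?m \<le> ln (real ?N) / real n" using n by (simp add: field_simps)
qed

end

theorem proposition5p3:
  fixes S :: "'a gorder"
  assumes "lower_complete_symbols S"
  shows "topological_entropy (sequence_space S) shift = ereal (ln (real (card (maximal_elements S))))"
proof -
  interpret lower_complete_symbols S by fact
  show ?thesis
    unfolding topological_entropy_def lattice_entropy_def
  proof (rule antisym)
    show "(SUP \<U>\<in>covers (open_lattice (sequence_space S)).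
          ereal (morphism_cover_entropy (open_lattice (sequence_space S))
            (open_preimage (sequence_space S) shift) \<U>))
        \<le> ereal (ln (real (card (maximal_elements S))))"
      by (intro SUP_least) (simp add: morphism_cover_entropy_shift_le)
    show "ereal (ln (real (card (maximal_elements S))))
        \<le> (SUP \<U>\<in>covers (open_lattice (sequence_space S)).
          ereal (morphism_cover_entropy (open_lattice (sequence_space S))
            (open_preimage (sequence_space S) shift) \<U>))"
      by (rule SUP_upper2[OF maximal_cylinders_cover])
        (simp add: morphism_cover_entropy_maximal_cylinders_ge)
  qed
qed

end
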